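(* For every $b>1$, the $b$-scaling strategy $D_b$ for identical parallel machines is $\frac{3b^2-b}{b-1}$-competitive for minimizing $\sum_jC_j$ (unit weights, all release dates $0$) on $m$ identical parallel machines. In particular, the ratio is minimized for $b=\frac{3+\sqrt6}{3}$, yielding a performance guarantee of $5+2\sqrt6\approx 9.899$.
   Context: An instance consists of $n$ jobs with processing times $p_j>0$, unit weights, all available at time $0$, and $m$ identical parallel machines; each machine processes at most one job at a time. $\mathrm{OPT}$ is the optimal (clairvoyant) objective value $\sum_jC_j$. Kill-and-restart model: processing times are unknown until completion; a probing of job $j$ for time $\tau$ on some machine completes $j$ after $p_j$ time units if $\tau\geq p_j$, otherwise it is aborted after $\tau$ time units with all progress lost; a job is probed on at most one machine at a time. The single-machine $b$-scaling sequence of probings: rounds $q\in\mathbb{Z}$ in increasing order starting from $-\infty$, in round $q$ each unfinished job is probed, in order of increasing index, for time $b^q$. The $m$-machine strategy $D_b$ performs this same sequence of probings but assigns them to machines in list-scheduling manner (each probing is started on the first available machine), as the limit when the starting round tends to $-\infty$; moreover, from the moment at which the number of remaining unfinished jobs becomes at most $m$, jobs are no longer aborted (each is run to completion). *)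

theory Defs
  imports Complex_Main
begin

text \<open>
  An instance is given by the number \<open>m\<close> of machines, the number \<open>n\<close> of jobs and the processing
  times \<open>p j\<close> of the jobs \<open>j < n\<close>; weights are one and release dates zero.
\<close>

definition valid_instance :: "nat \<Rightarrow> nat \<Rightarrow> (nat \<Rightarrow> real) \<Rightarrow> bool" where
  "valid_instance m n p \<longleftrightarrow> 1 \<le> m \<and> (\<forall>j<n. 0 < p j)"

text \<open>Job \<open>j\<close> is processed on machine \<open>\<mu> j\<close> during the interval from \<open>S j\<close> to \<open>S j + p j\<close>.\<close>

definition feasible_schedule ::
    "nat \<Rightarrow> nat \<Rightarrow> (nat \<Rightarrow> real) \<Rightarrow> (nat \<Rightarrow> nat) \<Rightarrow> (nat \<Rightarrow> real) \<Rightarrow> bool" where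
  "feasible_schedule m n p \<mu> S \<longleftrightarrow>
     (\<forall>j<n. \<mu> j < m \<and> 0 \<le> S j) \<and>
     (\<forall>i<n. \<forall>j<n. i \<noteq> j \<and> \<mu> i = \<mu> j \<longrightarrow> S i + p i \<le> S j \<or> S j + p j \<le> S i)"

definition OPT :: "nat \<Rightarrow> nat \<Rightarrow> (nat \<Rightarrow> real) \<Rightarrow> real" where
  "OPT m n p = Inf {\<Sum>j<n. S j + p j | \<mu> S. feasible_schedule m n p \<mu> S}"

text \<open>A strategy enters only through its cost \<open>A m n p\<close> on each instance.\<close>

definition competitive :: "(nat \<Rightarrow> nat \<Rightarrow> (nat \<Rightarrow> real) \<Rightarrow> real) \<Rightarrow> real \<Rightarrow> bool" where
  "competitive A c \<longleftrightarrow> (\<forall>m n p. valid_instance m n p \<longrightarrow> A m n p \<le> c * OPT m n p)"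

text \<open>The pair \<open>(q, j)\<close> stands for the probing of job \<open>j\<close> for time \<open>b powi q\<close> in round \<open>q\<close>.\<close>

definition probe_duration :: "real \<Rightarrow> (nat \<Rightarrow> real) \<Rightarrow> int \<times> nat \<Rightarrow> real" where
  "probe_duration b p = (\<lambda>(q, j). min (p j) (b powi q))"

text \<open>The probings of round \<open>q\<close> when the first round is \<open>q0\<close>: a job is still unfinished if it was
  not completed by its probings in the rounds \<open>q0, \<dots>, q - 1\<close>.\<close>

definition round_probes :: "real \<Rightarrow> nat \<Rightarrow> (nat \<Rightarrow> real) \<Rightarrow> int \<Rightarrow> int \<Rightarrow> (int \<times> nat) list" where
  "round_probes b n p q0 q =
     map (Pair q) (filter (\<lambda>j. \<forall>r\<in>{q0..<q}. b powi r < p j) [0..<n])"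

definition probes_before ::
    "real \<Rightarrow> nat \<Rightarrow> (nat \<Rightarrow> real) \<Rightarrow> int \<Rightarrow> int \<Rightarrow> nat \<Rightarrow> (int \<times> nat) list" where
  "probes_before b n p q0 q j =
     concat (map (round_probes b n p q0) [q0..q - 1]) @
     filter (\<lambda>(r, i). i < j) (round_probes b n p q0 q)"

text \<open>In the state \<open>a\<close>, machine \<open>i\<close> becomes available at time \<open>a i\<close>.\<close>

definition assign_probe :: "nat \<Rightarrow> (nat \<Rightarrow> real) \<Rightarrow> real \<Rightarrow> (nat \<Rightarrow> real)" where
  "assign_probe m a d = (let i = arg_min_on a {..<m} in a(i := a i + d))"

definition list_schedule :: "nat \<Rightarrow> real list \<Rightarrow> (nat \<Rightarrow> real)" where
  "list_schedule m ds = foldl (assign_probe m) (\<lambda>_. 0) ds"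

definition probe_start_from ::
    "real \<Rightarrow> nat \<Rightarrow> nat \<Rightarrow> (nat \<Rightarrow> real) \<Rightarrow> int \<Rightarrow> int \<Rightarrow> nat \<Rightarrow> real" where
  "probe_start_from b m n p q0 q j =
     Min (list_schedule m (map (probe_duration b p) (probes_before b n p q0 q j)) ` {..<m})"

text \<open>The limit exists: for all sufficiently small \<open>q0\<close>, decreasing \<open>q0\<close> puts further probings in
  front of the same sequence, so the starting times increase, and they stay bounded because the
  probing times form a geometric series.\<close>

definition probe_start :: "real \<Rightarrow> nat \<Rightarrow> nat \<Rightarrow> (nat \<Rightarrow> real) \<Rightarrow> int \<Rightarrow> nat \<Rightarrow> real" where
  "probe_start b m n p q j = Lim at_bot (\<lambda>q0. probe_start_from b m n p q0 q j)"

text \<open>The round in which job \<open>j\<close> is completed is the least \<open>q\<close> with \<open>p j \<le> b powi q\<close>.\<close>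

definition last_round :: "real \<Rightarrow> (nat \<Rightarrow> real) \<Rightarrow> nat \<Rightarrow> int" where
  "last_round b p j = \<lceil>log b (p j)\<rceil>"

text \<open>The completion times of the pure list schedule, in which the aborting never stops.\<close>

definition list_completion :: "real \<Rightarrow> nat \<Rightarrow> nat \<Rightarrow> (nat \<Rightarrow> real) \<Rightarrow> nat \<Rightarrow> real" where
  "list_completion b m n p j = probe_start b m n p (last_round b p j) j + p j"

text \<open>The first moment at which at most \<open>m\<close> jobs are unfinished. Up to this moment \<open>D\<^sub>b\<close> coincides
  with the list schedule above, and in that part no two probings of the same job overlap.\<close>

definition switch_time :: "real \<Rightarrow> nat \<Rightarrow> nat \<Rightarrow> (nat \<Rightarrow> real) \<Rightarrow> real" where
  "switch_time b m n p =
     Inf {t. 0 \<le> t \<and> card {j. j < n \<and> t < list_completion b m n p j} \<le> m}"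

text \<open>Round \<open>q\<close> probes job \<open>j\<close> at the switch time. A probing that would be aborted exactly at the
  switch time counts, since from this moment on no job is aborted; a probing that would start
  exactly then does not.\<close>

definition probed_at_switch ::
    "real \<Rightarrow> nat \<Rightarrow> nat \<Rightarrow> (nat \<Rightarrow> real) \<Rightarrow> nat \<Rightarrow> int \<Rightarrow> bool" where
  "probed_at_switch b m n p j q \<longleftrightarrow>
     q \<le> last_round b p j \<and>
     probe_start b m n p q j < switch_time b m n p \<and>
     switch_time b m n p \<le> probe_start b m n p q j + probe_duration b p (q, j)"

text \<open>At the switch time every remaining job has a machine of its own: a job that is being probed
  continues on its machine until it completes (the round \<open>q\<close> is unique in this case), any other
  remaining job is started immediately on a free machine.\<close>

definition completion_time :: "real \<Rightarrow> nat \<Rightarrow> nat \<Rightarrow> (nat \<Rightarrow> real) \<Rightarrow> nat \<Rightarrow> real" where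
  "completion_time b m n p j =
     (if list_completion b m n p j \<le> switch_time b m n p then list_completion b m n p j
      else if \<exists>q. probed_at_switch b m n p j q
           then probe_start b m n p (SOME q. probed_at_switch b m n p j q) j + p j
      else switch_time b m n p + p j)"

definition D :: "real \<Rightarrow> nat \<Rightarrow> nat \<Rightarrow> (nat \<Rightarrow> real) \<Rightarrow> real" where
  "D b m n p = (\<Sum>j<n. completion_time b m n p j)"

end

theory Submission
  imports Defs "HOL-Combinatorics.Transposition"
begin

text \<open>
  No machine idles before the completing probing of a job starts, so that probing starts at most
  \<open>1 / m\<close> times the total duration of all earlier probings. For two jobs \<open>j\<close> and \<open>k\<close>, the time spent on
  \<open>k\<close> before \<open>j\<close>'s last probing plus the time spent on \<open>j\<close> before \<open>k\<close>'s last probing is a geometric sum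
  of at most \<open>A * min (p j) (p k)\<close>, where \<open>A = (b\<^sup>2 + 2 * b - 1) / (b - 1)\<close>. Summing over all ordered
  pairs, and comparing with the optimum through the volume \<open>m * t\<close> that \<open>m\<close> machines can complete by
  time \<open>t\<close>, bounds the total start time by \<open>A * OPT\<close>; the processing times themselves add at most
  \<open>OPT\<close>. Finally \<open>A + 1\<close> is at most the claimed ratio, the difference being \<open>2 * (b - 1)\<close>.
\<close>

section \<open>List scheduling\<close>

lemma arg_min_on_machine:
  fixes a :: "nat \<Rightarrow> real"
  assumes "1 \<le> m"
  shows arg_min_on_machine_less: "arg_min_on a {..<m} < m"
    and arg_min_on_machine_le: "\<And>i. i < m \<Longrightarrow> a (arg_min_on a {..<m}) \<le> a i"
proof -
  have ne: "finite {..<m}" "{..<m} \<noteq> {}"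
    using assms lessThan_empty_iff[of m] by (auto simp: bot_nat_def)
  show "arg_min_on a {..<m} < m"
    using arg_min_if_finite(1)[OF ne, of a] by simp
  show "a (arg_min_on a {..<m}) \<le> a i" if "i < m" for i
    using arg_min_if_finite(2)[OF ne, of a] that by force
qed

lemma Min_load_eq:
  fixes a :: "nat \<Rightarrow> real"
  assumes "1 \<le> m"
  shows "Min (a ` {..<m}) = a (arg_min_on a {..<m})"
  using arg_min_on_machine[OF assms] by (intro Min_eqI) auto

text \<open>Domination is taken up to renaming machines: from different loads the same probing may
  go to different machines, so a machine-by-machine comparison is not preserved by
  \<open>assign_probe\<close>.\<close>

definition load_dominated :: "nat \<Rightarrow> (nat \<Rightarrow> real) \<Rightarrow> (nat \<Rightarrow> real) \<Rightarrow> bool" where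
  "load_dominated m a a' \<longleftrightarrow> (\<exists>\<pi>. bij_betw \<pi> {..<m} {..<m} \<and> (\<forall>i<m. a i \<le> a' (\<pi> i)))"

lemma load_dominated_pointwise: "(\<And>i. i < m \<Longrightarrow> a i \<le> a' i) \<Longrightarrow> load_dominated m a a'"
  unfolding load_dominated_def by (rule exI[of _ id]) auto

lemma load_dominated_Min:
  assumes m: "1 \<le> m" and dom: "load_dominated m a a'"
  shows "Min (a ` {..<m}) \<le> Min (a' ` {..<m})"
proof -
  obtain \<pi> where \<pi>: "bij_betw \<pi> {..<m} {..<m}" "\<forall>i<m. a i \<le> a' (\<pi> i)"
    using dom unfolding load_dominated_def by blast
  define i' where "i' = arg_min_on a' {..<m}"
  have "i' < m"
    using arg_min_on_machine_less[OF m] by (simp add: i'_def)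
  then obtain k where "k < m" "\<pi> k = i'"
    using \<pi>(1) by (metis bij_betw_iff_bijections lessThan_iff)
  then have "a (arg_min_on a {..<m}) \<le> a' i'"
    using \<pi>(2) arg_min_on_machine_le[OF m, of k a] by force
  then show ?thesis
    by (simp add: Min_load_eq[OF m] i'_def)
qed

text \<open>The matching can be rearranged by one transposition such that it pairs the two least loaded
  machines.\<close>

lemma load_dominated_assign_probe:
  assumes m: "1 \<le> m" and dom: "load_dominated m a a'"
  shows "load_dominated m (assign_probe m a d) (assign_probe m a' d)"
proof -
  obtain \<pi> where \<pi>: "bij_betw \<pi> {..<m} {..<m}" "\<forall>i<m. a i \<le> a' (\<pi> i)"
    using dom unfolding load_dominated_def by blast
  define i where "i = arg_min_on a {..<m}"
  define i' where "i' = arg_min_on a' {..<m}"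
  have i: "i < m" "\<And>k. k < m \<Longrightarrow> a i \<le> a k"
    using arg_min_on_machine[OF m] by (auto simp: i_def)
  have i': "i' < m" "\<And>k. k < m \<Longrightarrow> a' i' \<le> a' k"
    using arg_min_on_machine[OF m] by (auto simp: i'_def)
  obtain k where k: "k < m" "\<pi> k = i'"
    using \<pi>(1) i'(1) by (metis bij_betw_iff_bijections lessThan_iff)
  have \<pi>_less: "\<pi> l < m" if "l < m" for l
    using \<pi>(1) that by (metis bij_betwE lessThan_iff)
  define \<rho> where "\<rho> = \<pi> \<circ> transpose i k"
  have "transpose i k l < m" if "l < m" for l
    using i(1) k(1) that by (simp add: transpose_def)
  then have "bij_betw (transpose i k) {..<m} {..<m}"
    by (intro bij_betw_byWitness[where f' = "transpose i k"]) auto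
  then have bij: "bij_betw \<rho> {..<m} {..<m}"
    unfolding \<rho>_def using \<pi>(1) by (rule bij_betw_trans)
  have \<rho>_i: "\<rho> i = i'"
    by (simp add: \<rho>_def k)
  have le: "a l \<le> a' (\<rho> l)" if l: "l < m" for l
  proof -
    consider "l = i" | "l = k" "l \<noteq> i" | "l \<noteq> i" "l \<noteq> k"
      by blast
    then show ?thesis
    proof cases
      case 1
      then show ?thesis
        using i(2)[OF k(1)] \<pi>(2) k \<rho>_i by force
    next
      case 2
      then have "a l \<le> a' i'"
        using \<pi>(2) k by force
      also have "\<dots> \<le> a' (\<pi> i)"
        using i' \<pi>_less i(1) by blast
      finally show ?thesis
        using 2 by (simp add: \<rho>_def)
    next
      case 3
      then show ?thesis
        using \<pi>(2) l by (simp add: \<rho>_def)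
    qed
  qed
  \<comment> \<open>By injectivity only \<open>i\<close> is matched with \<open>i'\<close>, so the
    added \<open>d\<close> falls on one matched pair.\<close>
  have "\<rho> l \<noteq> i'" if "l < m" "l \<noteq> i" for l
    using bij \<rho>_i i(1) that by (metis bij_betw_iff_bijections lessThan_iff)
  then have "\<forall>l<m. assign_probe m a d l \<le> assign_probe m a' d (\<rho> l)"
    using le \<rho>_i i(1) unfolding assign_probe_def Let_def i_def[symmetric] i'_def[symmetric] by auto
  then show ?thesis
    unfolding load_dominated_def using bij by blast
qed

lemma load_dominated_foldl:
  assumes "1 \<le> m" and "load_dominated m a a'"
  shows "load_dominated m (foldl (assign_probe m) a ds) (foldl (assign_probe m) a' ds)"
  using assms(2)
  by (induction ds arbitrary: a a') (auto intro: load_dominated_assign_probe[OF assms(1)])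

lemma foldl_assign_probe_increasing:
  assumes "\<forall>d\<in>set ds. 0 \<le> d"
  shows "a i \<le> foldl (assign_probe m) a ds i"
  using assms
proof (induction ds arbitrary: a)
  case (Cons d ds)
  have "a i \<le> assign_probe m a d i"
    using Cons.prems by (auto simp: assign_probe_def Let_def)
  also have "\<dots> \<le> foldl (assign_probe m) (assign_probe m a d) ds i"
    using Cons by auto
  finally show ?case
    by simp
qed auto

lemma sum_assign_probe:
  assumes "1 \<le> m"
  shows "(\<Sum>i<m. assign_probe m a d i) = (\<Sum>i<m. a i) + d"
proof -
  define k where "k = arg_min_on a {..<m}"
  have "k < m"
    using arg_min_on_machine_less[OF assms] by (simp add: k_def)
  have "(\<Sum>i<m. assign_probe m a d i) = (\<Sum>i<m. a i + (if i = k then d else 0))"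
    by (intro sum.cong) (auto simp: assign_probe_def Let_def k_def)
  also have "\<dots> = (\<Sum>i<m. a i) + d"
    using \<open>k < m\<close> by (simp add: sum.distrib)
  finally show ?thesis .
qed

lemma sum_list_schedule:
  assumes "1 \<le> m"
  shows "(\<Sum>i<m. list_schedule m ds i) = sum_list ds"
proof -
  have "(\<Sum>i<m. foldl (assign_probe m) a ds i) = (\<Sum>i<m. a i) + sum_list ds" for a
    by (induction ds arbitrary: a) (auto simp: sum_assign_probe[OF assms])
  then show ?thesis
    by (simp add: list_schedule_def)
qed

text \<open>The least load is at most the average load, and the loads add up to the total
  duration.\<close>

lemma Min_list_schedule_le:
  assumes "1 \<le> m"
  shows "Min (list_schedule m ds ` {..<m}) \<le> sum_list ds / m"
proof -
  have "real m * Min (list_schedule m ds ` {..<m}) \<le> (\<Sum>i<m. list_schedule m ds i)"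
    using sum_mono[of "{..<m}" "\<lambda>_. Min (list_schedule m ds ` {..<m})" "list_schedule m ds"]
    by simp
  then show ?thesis
    using assms by (simp add: sum_list_schedule[OF assms] field_simps)
qed

lemma Min_list_schedule_append:
  assumes "1 \<le> m" and "\<forall>d\<in>set ds. 0 \<le> d"
  shows "Min (list_schedule m es ` {..<m}) \<le> Min (list_schedule m (es @ ds) ` {..<m})"
  unfolding list_schedule_def foldl_append
  by (intro load_dominated_Min[OF assms(1)] load_dominated_pointwise
      foldl_assign_probe_increasing[OF assms(2)])

text \<open>The loads left by \<open>es\<close> dominate the zero loads, and domination survives the
  common suffix \<open>ds\<close>.\<close>

lemma Min_list_schedule_prepend:
  assumes "1 \<le> m" and "\<forall>d\<in>set es. 0 \<le> d"
  shows "Min (list_schedule m ds ` {..<m}) \<le> Min (list_schedule m (es @ ds) ` {..<m})"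
  unfolding list_schedule_def foldl_append
  using foldl_assign_probe_increasing[OF assms(2), of "\<lambda>_. 0"]
  by (intro load_dominated_Min[OF assms(1)] load_dominated_foldl[OF assms(1)]
      load_dominated_pointwise) auto

section \<open>Lower bounds on the optimum\<close>

text \<open>Induction on the number of intervals, removing the one that starts last: since lengths
  are positive, all others end by its start, which becomes the new \<open>t\<close>.\<close>

lemma disjoint_intervals_length_le:
  fixes S p :: "nat \<Rightarrow> real"
  assumes "finite K" and "\<And>k. k \<in> K \<Longrightarrow> 0 < p k \<and> 0 \<le> S k \<and> S k + p k \<le> t" and "0 \<le> t"
    and "\<And>i k. i \<in> K \<Longrightarrow> k \<in> K \<Longrightarrow> i \<noteq> k \<Longrightarrow> S i + p i \<le> S k \<or> S k + p k \<le> S i"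
  shows "sum p K \<le> t"
  using assms
proof (induction "card K" arbitrary: K t)
  case 0
  then show ?case by simp
next
  case (Suc c)
  have "K \<noteq> {}"
    using Suc.hyps(2) by auto
  then have "Max (S ` K) \<in> S ` K"
    using Suc.prems(1) by simp
  then obtain k where k: "k \<in> K" and S_k: "Max (S ` K) = S k"
    by auto
  have S_le: "S i \<le> S k" if "i \<in> K" for i
    unfolding S_k[symmetric] using Suc.prems(1) that by simp
  have "sum p (K - {k}) \<le> S k"
  proof (rule Suc.hyps(1))
    show "c = card (K - {k})"
      using Suc.hyps(2) k Suc.prems(1) by simp
    show "0 < p i \<and> 0 \<le> S i \<and> S i + p i \<le> S k" if "i \<in> K - {k}" for i
      using Suc.prems(2)[of i] Suc.prems(2)[of k] Suc.prems(4)[of i k] S_le[of i] k that by force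
    show "0 \<le> S k"
      using Suc.prems(2) k by blast
  qed (use Suc.prems in auto)
  then show ?case
    using Suc.prems(2)[OF k] k Suc.prems(1) by (simp add: sum.remove)
qed

text \<open>The completed jobs of one machine occupy disjoint intervals within
  \<open>[0, t]\<close>; grouping by machine gives the factor \<open>m\<close>.\<close>

lemma completed_volume_le:
  fixes t :: real
  assumes inst: "valid_instance m n p" and feas: "feasible_schedule m n p \<mu> S" and "0 \<le> t"
  shows "(\<Sum>k | k < n \<and> S k + p k \<le> t. p k) \<le> m * t"
proof -
  define K where "K = {k. k < n \<and> S k + p k \<le> t}"
  have "sum p K = (\<Sum>i<m. \<Sum>k\<in>{k \<in> K. \<mu> k = i}. p k)"
    using feas by (intro sum.group[symmetric]) (auto simp: K_def feasible_schedule_def)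
  also have "\<dots> \<le> (\<Sum>i<m. t)"
    using assms by (intro sum_mono disjoint_intervals_length_le[where S = S])
      (auto simp: K_def feasible_schedule_def valid_instance_def)
  finally show ?thesis
    by (simp add: K_def)
qed

text \<open>For every pair of jobs, the one completed first counts towards the volume completed up to the
  completion time of the other.\<close>

lemma feasible_cost_ge_pairs:
  assumes inst: "valid_instance m n p" and feas: "feasible_schedule m n p \<mu> S"
  shows "(\<Sum>j<n. \<Sum>k<n. min (p k) (p j)) \<le> 2 * m * (\<Sum>j<n. S j + p j)"
proof -
  define e where "e k j = (if S k + p k \<le> S j + p j then p k else 0)" for k j
  have pos: "0 < p j" if "j < n" for j
    using inst that by (simp add: valid_instance_def)
  have "(\<Sum>j<n. \<Sum>k<n. min (p k) (p j)) \<le> (\<Sum>j<n. \<Sum>k<n. e k j + e j k)"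
    using pos by (intro sum_mono) (auto simp: e_def min_def less_imp_le add_nonneg_nonneg)
  also have "\<dots> = 2 * (\<Sum>j<n. \<Sum>k<n. e k j)"
    using sum.swap[of e "{..<n}" "{..<n}"] by (simp add: sum.distrib)
  also have "(\<Sum>j<n. \<Sum>k<n. e k j) \<le> (\<Sum>j<n. m * (S j + p j))"
  proof (intro sum_mono)
    fix j assume "j \<in> {..<n}"
    then have "0 \<le> S j + p j"
      using feas pos[of j] by (auto simp: feasible_schedule_def)
    then have "(\<Sum>k | k < n \<and> S k + p k \<le> S j + p j. p k) \<le> m * (S j + p j)"
      by (rule completed_volume_le[OF assms])
    also have "(\<Sum>k | k < n \<and> S k + p k \<le> S j + p j. p k) = (\<Sum>k<n. e k j)"
      by (simp add: e_def sum.inter_filter[symmetric] lessThan_def)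
    finally show "(\<Sum>k<n. e k j) \<le> m * (S j + p j)" .
  qed
  finally show ?thesis
    by (simp add: sum_distrib_left mult.assoc)
qed

text \<open>\<open>OPT\<close> is an infimum of reals, so bounding it from below requires a nonempty
  set of costs.\<close>

lemma feasible_schedule_exists:
  assumes "valid_instance m n p"
  shows "\<exists>\<mu> S. feasible_schedule m n p \<mu> S"
proof -
  have pos: "0 \<le> p j" if "j < n" for j
    using assms that by (simp add: valid_instance_def less_imp_le)
  have step: "(\<Sum>k<i. p k) + p i \<le> (\<Sum>k<j. p k)" if "i < j" "j < n" for i j
  proof -
    have "(\<Sum>k<i. p k) + p i = (\<Sum>k<Suc i. p k)"
      by simp
    also have "\<dots> \<le> (\<Sum>k<j. p k)"
      using that pos by (intro sum_mono2) auto
    finally show ?thesis .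
  qed
  \<comment> \<open>All jobs run consecutively on machine \<open>0\<close>, in order of
    index.\<close>
  have "feasible_schedule m n p (\<lambda>_. 0) (\<lambda>j. \<Sum>k<j. p k)"
    using assms pos step unfolding feasible_schedule_def valid_instance_def
    by (auto intro!: sum_nonneg simp: neq_iff)
  then show ?thesis
    by blast
qed

lemma OPT_greatest:
  assumes "valid_instance m n p"
    and "\<And>\<mu> S. feasible_schedule m n p \<mu> S \<Longrightarrow> x \<le> (\<Sum>j<n. S j + p j)"
  shows "x \<le> OPT m n p"
  unfolding OPT_def using assms feasible_schedule_exists[OF assms(1)]
  by (intro cInf_greatest) auto

lemma OPT_ge_processing:
  assumes "valid_instance m n p"
  shows "(\<Sum>j<n. p j) \<le> OPT m n p"
  by (rule OPT_greatest[OF assms], rule sum_mono) (auto simp: feasible_schedule_def)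

lemma OPT_ge_pairs:
  assumes "valid_instance m n p"
  shows "(\<Sum>j<n. \<Sum>k<n. min (p k) (p j)) / (2 * m) \<le> OPT m n p"
  using assms feasible_cost_ge_pairs[OF assms]
  by (intro OPT_greatest) (auto simp: valid_instance_def field_simps)

section \<open>The work performed by the scaling strategy\<close>

text \<open>Dropping \<open>b powi q0\<close> from the closed form leaves a bound that does not
  depend on the first round.\<close>

lemma sum_powi_atLeastLessThan_le:
  fixes b :: real
  assumes "1 < b"
  shows "(\<Sum>r\<in>{q0..<q}. b powi r) \<le> b powi q / (b - 1)"
proof (cases "q0 \<le> q")
  case True
  then have "(\<Sum>r\<in>{q0..<q}. b powi r) = (b powi q - b powi q0) / (b - 1)"
  proof (induction q rule: int_ge_induct)
    case (step q)
    have "{q0..<q + 1} = insert q {q0..<q}"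
      using step.hyps by auto
    moreover have "b powi (q + 1) = b * b powi q"
      using assms by (simp add: power_int_add_1)
    ultimately show ?case
      using step.IH assms by (simp add: divide_simps) (simp add: algebra_simps)
  qed simp
  also have "\<dots> \<le> b powi q / (b - 1)"
    using assms by (intro divide_right_mono) auto
  finally show ?thesis .
qed (use assms in auto)

text \<open>As \<open>q\<close> decreases, the values increase and stay bounded, so they converge to
  their supremum. \<open>Lim\<close> is only a description and says nothing until convergence is
  known.\<close>

lemma Lim_at_bot_antimono_bounded:
  fixes f :: "int \<Rightarrow> real"
  assumes anti: "\<And>q. q \<le> N \<Longrightarrow> f q \<le> f (q - 1)" and bound: "\<And>q. q \<le> N \<Longrightarrow> f q \<le> B"
  shows "(f \<longlongrightarrow> Lim at_bot f) at_bot"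
proof -
  have mono: "f r \<le> f q" if "q \<le> r" "r \<le> N" for q r
    using that(1)
  proof (induction q rule: int_le_induct)
    case (step q)
    then show ?case
      using anti[of q] that(2) by simp
  qed simp
  have bdd: "bdd_above (f ` {..N})"
    using bound by (auto intro!: bdd_aboveI[of _ B])
  have "(f \<longlongrightarrow> Sup (f ` {..N})) at_bot"
  proof (rule order_tendstoI)
    fix a assume "a < Sup (f ` {..N})"
    then obtain r where "r \<le> N" "a < f r"
      using less_cSup_iff[OF _ bdd] by auto
    then have "\<forall>q\<le>r. a < f q"
      using mono by force
    then show "eventually (\<lambda>q. a < f q) at_bot"
      by (auto simp: eventually_at_bot_linorder)
  next
    fix a assume a: "Sup (f ` {..N}) < a"
    have "f q < a" if "q \<le> N" for q
      using cSup_upper[OF _ bdd, of "f q"] that a by force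
    then show "eventually (\<lambda>q. f q < a) at_bot"
      by (auto simp: eventually_at_bot_linorder)
  qed
  then show ?thesis
    using tendsto_Lim[OF trivial_limit_at_bot_linorder] by metis
qed

section \<open>Rounds, and the dependence of starting times on the first round\<close>

locale scaling =
  fixes b :: real and m n :: nat and p :: "nat \<Rightarrow> real"
  assumes b_gt_1: "1 < b" and valid: "valid_instance m n p"
begin

abbreviation Q :: "nat \<Rightarrow> int" where
  "Q \<equiv> last_round b p"

lemma m_ge_1: "1 \<le> m" and p_pos: "j < n \<Longrightarrow> 0 < p j"
  using valid by (auto simp: valid_instance_def)

lemma powi_pos [simp]: "0 < b powi q"
  using b_gt_1 by simp

lemma powi_less_iff:
  assumes "j < n"
  shows "b powi r < p j \<longleftrightarrow> r < Q j"
proof -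
  have "b powi r < p j \<longleftrightarrow> real_of_int r < log b (p j)"
    using less_log_iff[OF b_gt_1 p_pos[OF assms], of "real_of_int r"] b_gt_1
    by (simp add: powr_real_of_int')
  then show ?thesis
    by (simp add: last_round_def less_ceiling_iff)
qed

lemma p_le_powi: "j < n \<Longrightarrow> Q j \<le> r \<Longrightarrow> p j \<le> b powi r"
  using powi_less_iff[of j r] by auto

text \<open>Round \<open>Q j - 1\<close> is still too short for job \<open>j\<close>; the factor
  \<open>b\<close> is the step to the next round.\<close>

lemma powi_last_round_less:
  assumes "j < n"
  shows "b powi Q j < b * p j"
proof -
  have "b powi Q j = b * b powi (Q j - 1)"
    using b_gt_1 by (simp add: power_int_diff)
  then show ?thesis
    using powi_less_iff[OF assms, of "Q j - 1"] b_gt_1 by simp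
qed

lemma probe_duration_nonneg: "(r, k) \<in> set (probes_before b n p q0 q j) \<Longrightarrow> 0 \<le> probe_duration b p (r, k)"
  using p_pos by (fastforce simp: probes_before_def round_probes_def probe_duration_def less_imp_le)

text \<open>Once \<open>q0\<close> is no later than any completing round, the jobs probed in a round
  no longer depend on \<open>q0\<close>.\<close>

lemma round_probes_eq:
  assumes "\<forall>k<n. q0 \<le> Q k" and "q0 \<le> r"
  shows "round_probes b n p q0 r = map (Pair r) (filter (\<lambda>k. r \<le> Q k) [0..<n])"
proof -
  have "(\<forall>s\<in>{q0..<r}. b powi s < p k) \<longleftrightarrow> r \<le> Q k" if "k < n" for k
  proof
    assume *: "\<forall>s\<in>{q0..<r}. b powi s < p k"
    show "r \<le> Q k"
    \<comment> \<open>For \<open>r = q0\<close> the range of earlier rounds is empty, and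
      \<open>q0 \<le> Q k\<close> gives the claim.\<close>
    proof (cases "r = q0")
      case False
      then show ?thesis
        using * assms(2) powi_less_iff[OF that, of "r - 1"] by simp
    qed (use assms that in auto)
  qed (use powi_less_iff[OF that] in auto)
  then show ?thesis
    unfolding round_probes_def by (intro arg_cong[where f = "map _"] filter_cong) auto
qed

text \<open>No job completes in round \<open>q0 - 1\<close>, so the later rounds stay as they
  are.\<close>

lemma probes_before_pred:
  assumes "\<forall>k<n. q0 \<le> Q k" and "q0 \<le> q"
  shows "probes_before b n p (q0 - 1) q j
    = round_probes b n p (q0 - 1) (q0 - 1) @ probes_before b n p q0 q j"
proof -
  have eq: "round_probes b n p (q0 - 1) r = round_probes b n p q0 r" if "q0 \<le> r" for r
    using assms(1) that by (subst (1 2) round_probes_eq) force+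
  have "[q0 - 1..q - 1] = (q0 - 1) # [q0..q - 1]"
    using assms(2) by (simp add: upto_rec1)
  moreover have "concat (map (round_probes b n p (q0 - 1)) [q0..q - 1])
      = concat (map (round_probes b n p q0) [q0..q - 1])"
    by (intro arg_cong[where f = concat] map_cong) (auto simp: eq)
  ultimately show ?thesis
    using eq[OF assms(2)] by (simp add: probes_before_def)
qed

lemma probe_start_from_pred:
  assumes "\<forall>k<n. q0 \<le> Q k" and "q0 \<le> q"
  shows "probe_start_from b m n p q0 q j \<le> probe_start_from b m n p (q0 - 1) q j"
  unfolding probe_start_from_def probes_before_pred[OF assms] map_append
  using p_pos by (intro Min_list_schedule_prepend[OF m_ge_1])
    (auto simp: round_probes_def probe_duration_def less_imp_le)

text \<open>Round \<open>q\<close> lists jobs by increasing index, so its probings of jobs below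
  \<open>j\<close> form an initial segment of it.\<close>

lemma probes_before_prefix:
  assumes "q0 \<le> q" and "q < q'"
  shows "\<exists>ps. probes_before b n p q0 q' j = probes_before b n p q0 q j @ ps"
proof -
  \<comment> \<open>The cut at \<open>min j n\<close> also covers \<open>j \<ge> n\<close>.\<close>
  have split: "[0..<n] = [0..<min j n] @ [min j n..<n]"
    by (metis min.cobounded2 upt_add_eq_append le_add_diff_inverse zero_le)
  have "filter (\<lambda>i. P i \<and> i < j) [0..<min j n] = filter P [0..<min j n]" for P
    by (intro filter_cong) auto
  moreover have "filter (\<lambda>i. P i \<and> i < j) [min j n..<n] = []" for P
    by (auto simp: filter_empty_conv)
  ultimately have "\<exists>ps. round_probes b n p q0 q = filter (\<lambda>(r, i). i < j) (round_probes b n p q0 q) @ ps"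
    unfolding round_probes_def split by (auto simp: filter_map o_def)
  then obtain ps where ps: "round_probes b n p q0 q
      = filter (\<lambda>(r, i). i < j) (round_probes b n p q0 q) @ ps"
    by blast
  have "[q0..q' - 1] = [q0..q - 1] @ q # [q + 1..q' - 1]"
    using assms by (simp add: upto_split3)
  then show ?thesis
    unfolding probes_before_def by simp (metis ps append_assoc)
qed

lemma probe_start_from_mono:
  assumes "q0 \<le> q" and "q \<le> q'"
  shows "probe_start_from b m n p q0 q j \<le> probe_start_from b m n p q0 q' j"
proof (cases "q = q'")
  case False
  then obtain ps where ps: "probes_before b n p q0 q' j = probes_before b n p q0 q j @ ps"
    using probes_before_prefix assms by fastforce
  have "\<forall>d\<in>set (map (probe_duration b p) ps). 0 \<le> d"
    using probe_duration_nonneg[of _ _ q0 q' j] by (auto simp: ps)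
  then show ?thesis
    unfolding probe_start_from_def ps map_append by (rule Min_list_schedule_append[OF m_ge_1])
qed simp

section \<open>Time spent on each job before a given probing\<close>

text \<open>An upper bound on the total time for which job \<open>k\<close> is probed before the probing of job \<open>j\<close>
  in round \<open>q\<close>.\<close>

definition work :: "nat \<Rightarrow> int \<Rightarrow> nat \<Rightarrow> real" where
  "work k q j = b powi min (Q k) q / (b - 1)
    + (if Q k < q then p k else if k < j then min (p k) (b powi q) else 0)"

text \<open>Regroups the total duration from rounds to jobs, so that the share of each job can be
  bounded separately.\<close>

lemma sum_list_probes_before:
  assumes "\<forall>k<n. q0 \<le> Q k" and "q0 \<le> q"
  shows "sum_list (map (probe_duration b p) (probes_before b n p q0 q j))
    = (\<Sum>k<n. (\<Sum>r\<in>{q0..<q}. if r \<le> Q k then min (p k) (b powi r) else 0)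
        + (if q \<le> Q k \<and> k < j then min (p k) (b powi q) else 0))"
proof -
  have round: "sum_list (map (probe_duration b p) (round_probes b n p q0 r))
      = (\<Sum>k<n. if r \<le> Q k then min (p k) (b powi r) else 0)" if "q0 \<le> r" for r
    by (simp add: round_probes_eq[OF assms(1) that] o_def probe_duration_def sum_list_map_filter'
        interv_sum_list_conv_sum_set_nat lessThan_atLeast0)
  have last: "sum_list (map (probe_duration b p) (filter (\<lambda>(r, i). i < j) (round_probes b n p q0 q)))
      = (\<Sum>k<n. if q \<le> Q k \<and> k < j then min (p k) (b powi q) else 0)"
    by (simp add: round_probes_eq[OF assms] o_def filter_map probe_duration_def sum_list_map_filter'
        interv_sum_list_conv_sum_set_nat lessThan_atLeast0 conj_commute)
  have concat: "sum_list (map g (concat xss)) = sum_list (map (\<lambda>xs. sum_list (map g xs)) xss)"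
    for g :: "int \<times> nat \<Rightarrow> real" and xss
    by (induction xss) auto
  have "sum_list (map (probe_duration b p) (concat (map (round_probes b n p q0) [q0..q - 1])))
      = (\<Sum>r\<in>{q0..<q}. sum_list (map (probe_duration b p) (round_probes b n p q0 r)))"
    by (simp add: concat o_def interv_sum_list_conv_sum_set_int
        atLeastLessThanPlusOne_atLeastAtMost_int[symmetric])
  also have "\<dots> = (\<Sum>r\<in>{q0..<q}. \<Sum>k<n. if r \<le> Q k then min (p k) (b powi r) else 0)"
    by (intro sum.cong) (auto simp: round)
  also have "\<dots> = (\<Sum>k<n. \<Sum>r\<in>{q0..<q}. if r \<le> Q k then min (p k) (b powi r) else 0)"
    by (rule sum.swap)
  finally show ?thesis
    by (simp add: probes_before_def last sum.distrib)
qed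

text \<open>The aborted probings before round \<open>q\<close> are bounded by the geometric series.
  If \<open>Q k < q\<close>, the completing probing adds at most \<open>p k\<close>; otherwise round
  \<open>q\<close> itself counts when \<open>k < j\<close>.\<close>

lemma sum_probes_le_work:
  assumes "q0 \<le> Q k" and "k < n"
  shows "(\<Sum>r\<in>{q0..<q}. if r \<le> Q k then min (p k) (b powi r) else 0)
        + (if q \<le> Q k \<and> k < j then min (p k) (b powi q) else 0) \<le> work k q j"
proof (cases "Q k < q")
  case True
  have "(\<Sum>r\<in>{q0..<q}. if r \<le> Q k then min (p k) (b powi r) else 0)
      = (\<Sum>r\<in>insert (Q k) {q0..<Q k}. min (p k) (b powi r))"
    using assms True by (intro sum.mono_neutral_cong_right) auto
  also have "\<dots> \<le> p k + (\<Sum>r\<in>{q0..<Q k}. b powi r)"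
    by (simp add: add_mono sum_mono)
  finally show ?thesis
    using sum_powi_atLeastLessThan_le[OF b_gt_1, of q0 "Q k"] True by (simp add: work_def)
next
  case False
  have "(\<Sum>r\<in>{q0..<q}. if r \<le> Q k then min (p k) (b powi r) else 0) \<le> (\<Sum>r\<in>{q0..<q}. b powi r)"
    by (intro sum_mono) (auto simp: less_imp_le)
  then show ?thesis
    using sum_powi_atLeastLessThan_le[OF b_gt_1, of q0 q] False by (simp add: work_def)
qed

lemma probe_start_from_le:
  assumes "\<forall>k<n. q0 \<le> Q k" and "q0 \<le> q"
  shows "probe_start_from b m n p q0 q j \<le> (\<Sum>k<n. work k q j) / m"
proof -
  have "probe_start_from b m n p q0 q j
      \<le> sum_list (map (probe_duration b p) (probes_before b n p q0 q j)) / m"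
    unfolding probe_start_from_def by (rule Min_list_schedule_le[OF m_ge_1])
  also have "\<dots> \<le> (\<Sum>k<n. work k q j) / m"
    unfolding sum_list_probes_before[OF assms]
    using assms(1) by (intro divide_right_mono sum_mono sum_probes_le_work) auto
  finally show ?thesis .
qed

text \<open>From this round downwards, lowering \<open>q0\<close> only prepends a round. The element
  \<open>q\<close> ensures \<open>q0 \<le> q\<close> and keeps the set nonempty for
  \<open>n = 0\<close>.\<close>

definition first_round :: "int \<Rightarrow> int" where
  "first_round q = Min (insert q (Q ` {..<n}))"

lemma le_first_round: "q0 \<le> first_round q \<longleftrightarrow> q0 \<le> q \<and> (\<forall>k<n. q0 \<le> Q k)"
  by (auto simp: first_round_def)

text \<open>Below \<open>first_round q\<close> the starting times increase as \<open>q0\<close>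
  decreases, and the bound by \<open>work\<close> is independent of \<open>q0\<close>.\<close>

lemma probe_start_tendsto:
  "((\<lambda>q0. probe_start_from b m n p q0 q j) \<longlongrightarrow> probe_start b m n p q j) at_bot"
  unfolding probe_start_def
  by (rule Lim_at_bot_antimono_bounded[of "first_round q"])
    (auto simp: le_first_round intro: probe_start_from_pred probe_start_from_le)

lemma probe_start_le: "probe_start b m n p q j \<le> (\<Sum>k<n. work k q j) / m"
proof (rule tendsto_upperbound[OF probe_start_tendsto])
  show "eventually (\<lambda>q0. probe_start_from b m n p q0 q j \<le> (\<Sum>k<n. work k q j) / m) at_bot"
    using eventually_le_at_bot[of "first_round q"]
    by eventually_elim (auto simp: le_first_round intro: probe_start_from_le)
qed simp

lemma probe_start_mono:
  assumes "q \<le> q'"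
  shows "probe_start b m n p q j \<le> probe_start b m n p q' j"
proof (rule tendsto_le[OF _ probe_start_tendsto probe_start_tendsto])
  show "eventually (\<lambda>q0. probe_start_from b m n p q0 q j \<le> probe_start_from b m n p q0 q' j) at_bot"
    using eventually_le_at_bot[of q] by eventually_elim (rule probe_start_from_mono[OF _ assms])
qed simp

text \<open>A job remaining at the switch time is either run in a probing that starts no later than its
  completing one, or its completing probing does not start before the switch time.\<close>

lemma completion_time_le_list_completion:
  assumes "j < n"
  shows "completion_time b m n p j \<le> list_completion b m n p j"
proof -
  have "probe_duration b p (Q j, j) = p j"
    using p_le_powi[OF assms order_refl] by (simp add: probe_duration_def)
  then have "probed_at_switch b m n p j (Q j)"
    if "switch_time b m n p < list_completion b m n p j"
      and "probe_start b m n p (Q j) j < switch_time b m n p"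
    using that by (simp add: probed_at_switch_def list_completion_def)
  \<comment> \<open>Any round that \<open>SOME\<close> may pick is at most \<open>Q j\<close>, so
    monotonicity applies.\<close>
  moreover have "probe_start b m n p (SOME q. probed_at_switch b m n p j q) j
      \<le> probe_start b m n p (Q j) j" if "\<exists>q. probed_at_switch b m n p j q"
    using someI_ex[OF that] by (intro probe_start_mono) (simp add: probed_at_switch_def)
  ultimately show ?thesis
    unfolding completion_time_def by (cases "probe_start b m n p (Q j) j < switch_time b m n p")
      (auto simp: list_completion_def not_less[symmetric])
qed

text \<open>The mutual delay is governed by the earlier completing round, whose length is below
  \<open>b\<close> times the shorter processing time. The constant is
  \<open>1 + (b + 1) * b / (b - 1)\<close>.\<close>

lemma work_pair_le:
  assumes "j < n" and "k < n"
  shows "work k (Q j) j + work j (Q k) k \<le> (b\<^sup>2 + 2 * b - 1) / (b - 1) * min (p k) (p j)"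
proof -
  have less: "work k (Q j) j + work j (Q k) k \<le> (b\<^sup>2 + 2 * b - 1) / (b - 1) * min (p k) (p j)"
    if "k < n" "j < n" "Q k < Q j" for k j
  proof -
    have "p k \<le> b powi Q k" "b powi Q k < p j"
      using p_le_powi[of k "Q k"] powi_less_iff[of j "Q k"] that by auto
    then have min: "min (p k) (p j) = p k"
      by simp
    \<comment> \<open>\<open>p k\<close> is the completing probing of \<open>k\<close>. Each job has
      a geometric sum for the rounds before \<open>Q k\<close>; the last term is the probing of
      \<open>j\<close> in round \<open>Q k\<close>, which counts only if
      \<open>j < k\<close>.\<close>
    have "work k (Q j) j + work j (Q k) k \<le> p k + (2 * (b powi Q k / (b - 1)) + b powi Q k)"
      using that by (simp add: work_def less_imp_le)
    also have "\<dots> = p k + (b + 1) / (b - 1) * b powi Q k"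
      using b_gt_1 by (simp add: divide_simps) (simp add: algebra_simps)
    also have "\<dots> \<le> p k + (b + 1) / (b - 1) * (b * p k)"
      using powi_last_round_less[OF that(1)] b_gt_1 by (intro add_left_mono mult_left_mono) auto
    also have "\<dots> = (b\<^sup>2 + 2 * b - 1) / (b - 1) * p k"
      using b_gt_1 by (simp add: field_simps power2_eq_square)
    finally show ?thesis
      by (simp add: min)
  qed
  consider "Q k < Q j" | "Q j < Q k" | "Q k = Q j"
    by linarith
  then show ?thesis
  proof cases
    case 1
    then show ?thesis
      using less assms by blast
  next
    case 2
    then show ?thesis
      using less[of j k] assms by (simp add: min.commute add.commute)
  next
    case 3
    \<comment> \<open>In a common completing round only the job of smaller index delays the other,
      hence a single extra \<open>b powi Q k\<close>.\<close>
    have "work k (Q j) j + work j (Q k) k \<le> 2 * (b powi Q k / (b - 1)) + b powi Q k"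
      unfolding work_def 3 using less_imp_le[OF powi_pos[of "Q j"]] by auto
    also have "\<dots> = (b + 1) / (b - 1) * b powi Q k"
      using b_gt_1 by (simp add: divide_simps) (simp add: algebra_simps)
    also have "\<dots> \<le> (b + 1) / (b - 1) * (b * min (p k) (p j))"
      using powi_last_round_less[OF assms(1)] powi_last_round_less[OF assms(2)] 3 b_gt_1
      by (intro mult_left_mono) (auto simp: min_def)
    also have "\<dots> = (b\<^sup>2 + b) / (b - 1) * min (p k) (p j)"
      by (simp add: field_simps power2_eq_square)
    also have "\<dots> \<le> (b\<^sup>2 + 2 * b - 1) / (b - 1) * min (p k) (p j)"
      using b_gt_1 p_pos[OF assms(1)] p_pos[OF assms(2)]
      by (intro mult_right_mono divide_right_mono) auto
    finally show ?thesis .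
  qed
qed

lemma D_le: "D b m n p \<le> (1 + (b\<^sup>2 + 2 * b - 1) / (b - 1)) * OPT m n p"
proof -
  define A where "A = (b\<^sup>2 + 2 * b - 1) / (b - 1)"
  define M where "M = (\<Sum>j<n. \<Sum>k<n. min (p k) (p j))"
  define W where "W = (\<Sum>j<n. \<Sum>k<n. work k (Q j) j)"
  have "0 \<le> A"
    unfolding A_def using b_gt_1 zero_le_power2[of b]
    by (intro divide_nonneg_nonneg) linarith+
  \<comment> \<open>Doubling matches each ordered pair with its reverse, the form that
    \<open>work_pair_le\<close> bounds.\<close>
  have "2 * W = (\<Sum>j<n. \<Sum>k<n. work k (Q j) j + work j (Q k) k)"
    using sum.swap[of "\<lambda>j k. work k (Q j) j" "{..<n}" "{..<n}"] by (simp add: W_def sum.distrib)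
  also have "\<dots> \<le> (\<Sum>j<n. \<Sum>k<n. A * min (p k) (p j))"
    unfolding A_def by (intro sum_mono work_pair_le) auto
  also have "\<dots> = A * M"
    by (simp add: M_def sum_distrib_left)
  finally have "W / m \<le> A * (M / (2 * m))"
    using m_ge_1 by (simp add: field_simps)
  also have "\<dots> \<le> A * OPT m n p"
    unfolding M_def by (intro mult_left_mono OPT_ge_pairs valid \<open>0 \<le> A\<close>)
  finally have W: "W / m \<le> A * OPT m n p" .
  have "D b m n p \<le> (\<Sum>j<n. list_completion b m n p j)"
    unfolding D_def by (intro sum_mono completion_time_le_list_completion) simp
  also have "\<dots> \<le> (\<Sum>j<n. (\<Sum>k<n. work k (Q j) j) / m + p j)"
    unfolding list_completion_def by (intro sum_mono add_right_mono probe_start_le)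
  also have "\<dots> = W / m + (\<Sum>j<n. p j)"
    by (simp add: W_def sum.distrib sum_divide_distrib)
  also have "\<dots> \<le> A * OPT m n p + OPT m n p"
    by (intro add_mono W OPT_ge_processing valid)
  finally show ?thesis
    by (simp add: A_def algebra_simps)
qed

end

section \<open>The competitive ratio\<close>

lemma competitive_D:
  assumes "1 < b"
  shows "competitive (D b) ((3 * b\<^sup>2 - b) / (b - 1))"
  unfolding competitive_def
proof (intro allI impI)
  fix m n p assume inst: "valid_instance m n p"
  interpret scaling b m n p
    using assms inst by unfold_locales
  have "0 \<le> (\<Sum>j<n. p j)"
    using p_pos by (intro sum_nonneg) (auto simp: less_imp_le)
  \<comment> \<open>Nonnegativity of \<open>OPT\<close> allows the factor from \<open>D_le\<close>
    to be replaced by a larger one.\<close>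
  then have "0 \<le> OPT m n p"
    using OPT_ge_processing[OF inst] by linarith
  moreover have "1 + (b\<^sup>2 + 2 * b - 1) / (b - 1) \<le> (3 * b\<^sup>2 - b) / (b - 1)"
  proof -
    have "(3 * b\<^sup>2 - b) - ((b - 1) + (b\<^sup>2 + 2 * b - 1)) = 2 * (b - 1)\<^sup>2"
      by (simp add: power2_eq_square algebra_simps)
    then have "(b - 1) + (b\<^sup>2 + 2 * b - 1) \<le> 3 * b\<^sup>2 - b"
      by (smt (verit) zero_le_power2)
    then have "((b - 1) + (b\<^sup>2 + 2 * b - 1)) / (b - 1) \<le> (3 * b\<^sup>2 - b) / (b - 1)"
      using assms by (intro divide_right_mono) auto
    then show ?thesis
      using assms by (simp only: add_divide_distrib) simp
  qed
  ultimately show "D b m n p \<le> (3 * b\<^sup>2 - b) / (b - 1) * OPT m n p"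
    using D_le mult_right_mono by (meson order_trans)
qed

text \<open>After clearing the denominator, the gap is a quadratic with the double root
  \<open>(3 + sqrt 6) / 3\<close>, which explains both constants.\<close>

lemma ratio_ge:
  fixes b :: real
  assumes "1 < b"
  shows "5 + 2 * sqrt 6 \<le> (3 * b\<^sup>2 - b) / (b - 1)"
proof -
  have "3 * b\<^sup>2 - b - (5 + 2 * sqrt 6) * (b - 1) = 3 * (b - (3 + sqrt 6) / 3)\<^sup>2"
    by (simp add: power2_eq_square field_simps)
  then have "(5 + 2 * sqrt 6) * (b - 1) \<le> 3 * b\<^sup>2 - b"
    by (smt (verit) zero_le_power2)
  then show ?thesis
    using assms by (simp add: pos_le_divide_eq)
qed

lemma ratio_eq:
  fixes b :: real
  assumes "b = (3 + sqrt 6) / 3"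
  shows "(3 * b\<^sup>2 - b) / (b - 1) = 5 + 2 * sqrt 6"
  unfolding assms by (simp add: power2_eq_square field_simps)

theorem theorem1p8:
  "(\<forall>b::real. 1 < b \<longrightarrow> competitive (D b) ((3 * b\<^sup>2 - b) / (b - 1)))
   \<and> is_arg_min (\<lambda>b::real. (3 * b\<^sup>2 - b) / (b - 1)) (\<lambda>b. 1 < b) ((3 + sqrt 6) / 3)
   \<and> (let b = (3 + sqrt 6) / 3 in (3 * b\<^sup>2 - b) / (b - 1)) = 5 + 2 * sqrt 6
   \<and> competitive (D ((3 + sqrt 6) / 3)) (5 + 2 * sqrt 6)
   \<and> \<bar>5 + 2 * sqrt 6 - 9.899\<bar> < (0.0005 :: real)"
proof -
  have gt: "1 < (3 + sqrt 6) / 3"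
    by simp
  have "is_arg_min (\<lambda>b::real. (3 * b\<^sup>2 - b) / (b - 1)) (\<lambda>b. 1 < b) ((3 + sqrt 6) / 3)"
    using gt ratio_ge unfolding is_arg_min_def ratio_eq[OF refl] by force
  moreover have "competitive (D ((3 + sqrt 6) / 3)) (5 + 2 * sqrt 6)"
    using competitive_D[OF gt] unfolding ratio_eq[OF refl] .
  \<comment> \<open>These bounds place \<open>5 + 2 * sqrt 6\<close> strictly between
    \<open>9.8988\<close> and \<open>9.8992\<close>.\<close>
  moreover have "2.4494 < sqrt 6" "sqrt 6 < 2.4496"
    by (rule real_less_rsqrt real_less_lsqrt; simp add: power2_eq_square)+
  then have "\<bar>5 + 2 * sqrt 6 - 9.899\<bar> < (0.0005 :: real)"
    unfolding abs_less_iff by auto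
  ultimately show ?thesis
    using competitive_D ratio_eq by (simp add: Let_def)
qed

end
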